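(* Let $\mathcal I$ be the space of possibly degenerate subsegments $[a,b]\subseteq[0,1]$, $0\le a\le b\le 1$. Let $f:\mathcal I\to\mathbb R$ be a continuous function such that $f([a,a])=0$ for all $a\in[0,1]$. Then for any positive integer $m$ there exist points $0\le x_1\le x_2\le\dots\le x_{m-1}\le 1$, giving a partition of $[0,1]$ into $m$ possibly degenerate segments \[ [0,1]=[0,x_1]\cup[x_1,x_2]\cup\dots\cup[x_{m-1},1], \] such that \[ f([0,x_1])=f([x_1,x_2])=\dots=f([x_{m-1},1]). \]
   Context: The space $\mathcal I$ is identified with $\{(a,b)\in\mathbb R^2 : 0\le a\le b\le 1\}$ with its usual topology, so continuity of $f$ means continuity as a function of the two real variables $(a,b)$. The function $f$ may take both positive and negative values. *)

theory Defs
  imports "HOL-Analysis.Analysis"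
begin

text \<open>The possibly degenerate segment \<open>[a,b]\<close> is encoded as the pair \<open>(a, b)\<close>; the topology on
  the set of segments is the subspace topology of the plane.\<close>

definition segments :: "(real \<times> real) set" where
  "segments = {(a, b). 0 \<le> a \<and> a \<le> b \<and> b \<le> 1}"

end

theory Submission
  imports Defs "HOL-Homology.Simplices" "HOL-Computational_Algebra.Primes"
    "Jordan_Normal_Form.Determinant"
begin

text \<open>
  A direct degree argument works only for prime (power) \<open>m\<close>, so the statement is strengthened until it
  can be iterated over the prime factors of \<open>m\<close>. The function \<open>f\<close> is replaced by a continuous
  \<open>F (a, b, y)\<close>, positive for large and negative for small \<open>y\<close>, for instance \<open>y - f [a, b]\<close>; one looks
  for a partition and a common \<open>y\<close> with \<open>F\<close> vanishing on all pieces. For prime \<open>p\<close>, the set \<open>S\<close> of those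
  \<open>(a, b, y)\<close> for which \<open>[a, b]\<close> can be split into \<open>p\<close> such pieces separates the bottom from the top,
  so it contains the zero set of a function \<open>G\<close> of the same kind (a signed distance to \<open>S\<close>), and a
  solution for \<open>G\<close> and \<open>k\<close> refines to a solution for \<open>F\<close> and \<open>p * k\<close>.

  Separation is a Sperner type count. A path from bottom to top, together with the simplex of
  partitions of its segments, is a map from a \<open>p\<close>-simplex to \<open>p\<close>-tuples of values of \<open>F\<close>. If it
  avoids the origin, each point gets a vector label supported on pieces with nonnegative value, or the
  label zero if there are none; then the determinants of the labels, summed over the boundary of a fine
  subdivision, cancel. The face over the top of the path contributes \<open>1\<close> by Sperner's lemma. The other
  \<open>p\<close> faces consist of partitions with a degenerate piece, and they all contribute the same number
  because only the position of that piece differs. Its denominator is prime to \<open>p\<close>, so \<open>1\<close> would be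
  divisible by \<open>p\<close>.
\<close>

section \<open>Determinants of real matrices indexed by functions\<close>

definition mdet :: "nat \<Rightarrow> (nat \<Rightarrow> nat \<Rightarrow> real) \<Rightarrow> real" where
  "mdet n a = Determinant.det (Matrix.mat n n (\<lambda>(i, j). a i j))"

text \<open>The coface map on vertex numbers, the increasing injection that misses \<open>k\<close>;
  composing with it deletes row \<open>k\<close>.\<close>

definition skip :: "nat \<Rightarrow> nat \<Rightarrow> nat" where
  "skip k j = (if j < k then j else Suc j)"

lemma mdet_cong:
  assumes "\<And>i j. i < n \<Longrightarrow> j < n \<Longrightarrow> a i j = b i j"
  shows "mdet n a = mdet n b"
  unfolding mdet_def using assms by (intro arg_cong[where f = Determinant.det]) (auto intro!: eq_matI)

lemma mdet_0 [simp]: "mdet 0 a = 1"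
  by (simp add: mdet_def)

lemma mdet_zero_column:
  assumes "j < n" "\<And>i. i < n \<Longrightarrow> a i j = 0"
  shows "mdet n a = 0"
  unfolding mdet_def using assms by (subst laplace_expansion_column[where j = j and n = n]) auto

lemma mdet_expand_last:
  "mdet (Suc n) a = (\<Sum>i\<le>n. a i n * ((-1) ^ (i + n) * mdet n (\<lambda>r. a (skip i r))))"
proof -
  let ?M = "Matrix.mat (Suc n) (Suc n) (\<lambda>(i, j). a i j)"
  have "cofactor ?M i n = (-1) ^ (i + n) * mdet n (\<lambda>r. a (skip i r))" if "i \<le> n" for i
  proof -
    have "mat_delete ?M i n = Matrix.mat n n (\<lambda>(r, j). a (skip i r) j)"
      using that by (auto simp: mat_delete_def skip_def intro!: eq_matI)
    then show ?thesis
      by (simp add: cofactor_def mdet_def)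
  qed
  then have "(\<Sum>i<Suc n. ?M $$ (i, n) * cofactor ?M i n)
      = (\<Sum>i<Suc n. a i n * ((-1) ^ (i + n) * mdet n (\<lambda>r. a (skip i r))))"
    by (intro sum.cong) auto
  then show ?thesis
    unfolding mdet_def
    by (subst laplace_expansion_column[where j = n and n = "Suc n"]) (auto simp: lessThan_Suc_atMost)
qed

lemma mdet_identical_columns:
  assumes "j < n" "k < n" "j \<noteq> k" "\<And>i. i < n \<Longrightarrow> a i j = a i k"
  shows "mdet n a = 0"
  unfolding mdet_def using assms
  by (intro det_identical_columns[of _ n j k]) (auto simp: Matrix.col_def)

lemma mdet_swap_columns:
  assumes "j < n" "k < n" "j \<noteq> k"
  shows "mdet n (\<lambda>i l. a i (Transposition.transpose j k l)) = - mdet n a"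
proof -
  have "Matrix.mat n n (\<lambda>(i, l). a i (Transposition.transpose j k l))
      = swapcols j k (Matrix.mat n n (\<lambda>(i, l). a i l))"
    using assms by (auto simp: Transposition.transpose_def intro!: eq_matI)
  then show ?thesis
    unfolding mdet_def using assms by (simp add: det_swapcols)
qed

text \<open>Append a second copy of column \<open>j\<close> to the array with n+1 rows and n
  columns: the determinant vanishes, and its expansion along the new column is this sum.\<close>

lemma alternating_sum_column:
  assumes "j < n"
  shows "(\<Sum>i\<le>n. (-1) ^ i * (a i j * mdet n (\<lambda>r. a (skip i r)))) = 0"
proof -
  let ?b = "\<lambda>i l. if l = n then a i j else a i l"
  have "0 = mdet (Suc n) ?b"
    using assms by (intro mdet_identical_columns[symmetric, of j _ n]) auto
  also have "\<dots> = (\<Sum>i\<le>n. a i j * ((-1) ^ (i + n) * mdet n (\<lambda>r. ?b (skip i r))))"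
    by (simp add: mdet_expand_last)
  also have "\<dots> = (\<Sum>i\<le>n. a i j * ((-1) ^ (i + n) * mdet n (\<lambda>r. a (skip i r))))"
    by (intro sum.cong refl arg_cong2[where f = times] mdet_cong) auto
  also have "\<dots> = (-1) ^ n * (\<Sum>i\<le>n. (-1) ^ i * (a i j * mdet n (\<lambda>r. a (skip i r))))"
    by (simp add: sum_distrib_left power_add algebra_simps)
  finally show ?thesis by simp
qed

lemma alternating_minors_zero_column:
  assumes "j < n" "\<And>i. i \<le> n \<Longrightarrow> a i j = 0"
  shows "(\<Sum>i\<le>n. (-1) ^ i * mdet n (\<lambda>r. a (skip i r))) = 0"
  using assms by (intro sum.neutral ballI) (auto intro!: mdet_zero_column[of j] simp: skip_def)

text \<open>Weighting each minor by the sum 1 of the deleted row and exchanging the sums gives zero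
  column by column. So the determinant is a closed cochain as long as all labels have sum 1.\<close>

lemma alternating_minors_affine:
  assumes "\<And>i. i \<le> n \<Longrightarrow> (\<Sum>j<n. a i j) = 1"
  shows "(\<Sum>i\<le>n. (-1) ^ i * mdet n (\<lambda>r. a (skip i r))) = 0"
proof -
  have "(\<Sum>i\<le>n. (-1) ^ i * mdet n (\<lambda>r. a (skip i r)))
      = (\<Sum>i\<le>n. \<Sum>j<n. (-1) ^ i * (a i j * mdet n (\<lambda>r. a (skip i r))))"
  proof (intro sum.cong refl)
    fix i assume "i \<in> {..n}"
    then have "(-1) ^ i * mdet n (\<lambda>r. a (skip i r))
        = (-1) ^ i * ((\<Sum>j<n. a i j) * mdet n (\<lambda>r. a (skip i r)))"
      by (simp add: assms)
    then show "(-1) ^ i * mdet n (\<lambda>r. a (skip i r))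
        = (\<Sum>j<n. (-1) ^ i * (a i j * mdet n (\<lambda>r. a (skip i r))))"
      by (simp add: sum_distrib_left sum_distrib_right)
  qed
  also have "\<dots> = 0"
    by (subst sum.swap) (simp add: alternating_sum_column)
  finally show ?thesis .
qed

text \<open>With the same weighting only column \<open>n\<close> survives, and what remains is the
  expansion along it. This turns a count over full simplices into a count over their faces.\<close>

lemma mdet_affine_rows:
  assumes "\<And>i. i \<le> n \<Longrightarrow> (\<Sum>j\<le>n. a i j) = 1"
  shows "mdet (Suc n) a = (-1) ^ n * (\<Sum>i\<le>n. (-1) ^ i * mdet n (\<lambda>r. a (skip i r)))"
proof -
  let ?m = "\<lambda>i. mdet n (\<lambda>r. a (skip i r))"
  have "(\<Sum>i\<le>n. (-1) ^ i * ?m i) = (\<Sum>i\<le>n. \<Sum>j\<le>n. (-1) ^ i * (a i j * ?m i))"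
  proof (intro sum.cong refl)
    fix i assume "i \<in> {..n}"
    then have "(-1) ^ i * ?m i = (-1) ^ i * ((\<Sum>j\<le>n. a i j) * ?m i)"
      by (simp add: assms)
    then show "(-1) ^ i * ?m i = (\<Sum>j\<le>n. (-1) ^ i * (a i j * ?m i))"
      by (simp add: sum_distrib_left sum_distrib_right)
  qed
  also have "\<dots> = (\<Sum>j\<le>n. \<Sum>i\<le>n. (-1) ^ i * (a i j * ?m i))"
    by (rule sum.swap)
  also have "\<dots> = (\<Sum>j\<in>{n}. \<Sum>i\<le>n. (-1) ^ i * (a i j * ?m i))"
    by (rule sum.mono_neutral_right) (auto simp: alternating_sum_column)
  finally have "(\<Sum>i\<le>n. (-1) ^ i * ?m i) = (\<Sum>i\<le>n. (-1) ^ i * (a i n * ?m i))"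
    by simp
  then have "(-1) ^ n * (\<Sum>i\<le>n. (-1) ^ i * ?m i) = (\<Sum>i\<le>n. a i n * ((-1) ^ (i + n) * ?m i))"
    by (simp add: sum_distrib_left power_add algebra_simps)
  then show ?thesis
    by (simp add: mdet_expand_last)
qed

lemma mdet_Ints:
  assumes "\<And>i j. i < n \<Longrightarrow> j < n \<Longrightarrow> c * a i j \<in> \<int>"
  shows "c ^ n * mdet n a \<in> \<int>"
proof -
  have "c ^ n * mdet n a = mdet n (\<lambda>i j. c * a i j)"
  proof -
    have "Matrix.mat n n (\<lambda>(i, j). c * a i j) = c \<cdot>\<^sub>m Matrix.mat n n (\<lambda>(i, j). a i j)"
      by (auto intro!: eq_matI)
    then show ?thesis by (simp add: mdet_def)
  qed
  also have "\<dots> = Determinant.det (map_mat of_int (Matrix.mat n n (\<lambda>(i, j). \<lfloor>c * a i j\<rfloor>)))"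
    unfolding mdet_def using assms
    by (intro arg_cong[where f = Determinant.det]) (auto intro!: eq_matI simp: of_int_floor)
  also have "\<dots> = of_int (Determinant.det (Matrix.mat n n (\<lambda>(i, j). \<lfloor>c * a i j\<rfloor>)))"
    by (rule of_int_hom.hom_det)
  finally show ?thesis by simp
qed

section \<open>Evaluation of cochains on subdivided simplices\<close>

text \<open>The pairing of a real cochain with an integral chain.\<close>

definition chain_eval :: "('b \<Rightarrow> real) \<Rightarrow> ('b \<Rightarrow>\<^sub>0 int) \<Rightarrow> real" where
  "chain_eval \<phi> c = (\<Sum>\<sigma>\<in>Poly_Mapping.keys c. of_int (Poly_Mapping.lookup c \<sigma>) * \<phi> \<sigma>)"

lemma chain_eval_superset:
  assumes "finite A" "Poly_Mapping.keys c \<subseteq> A"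
  shows "chain_eval \<phi> c = (\<Sum>\<sigma>\<in>A. of_int (Poly_Mapping.lookup c \<sigma>) * \<phi> \<sigma>)"
  unfolding chain_eval_def using assms
  by (intro sum.mono_neutral_left) (auto simp: in_keys_iff)

lemma chain_eval_0 [simp]: "chain_eval \<phi> 0 = 0"
  by (simp add: chain_eval_def)

lemma chain_eval_of [simp]: "chain_eval \<phi> (frag_of \<sigma>) = \<phi> \<sigma>"
  by (simp add: chain_eval_def)

lemma chain_eval_add: "chain_eval \<phi> (a + b) = chain_eval \<phi> a + chain_eval \<phi> b"
proof -
  let ?A = "Poly_Mapping.keys a \<union> Poly_Mapping.keys b"
  have "Poly_Mapping.keys (a + b) \<subseteq> ?A" by (rule keys_add)
  then show ?thesis
    by (simp add: chain_eval_superset[of ?A] Poly_Mapping.lookup_add algebra_simps sum.distrib)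
qed

lemma chain_eval_cmul: "chain_eval \<phi> (frag_cmul k c) = of_int k * chain_eval \<phi> c"
proof -
  have "Poly_Mapping.keys (frag_cmul k c) \<subseteq> Poly_Mapping.keys c" by (rule keys_cmul)
  then show ?thesis
    by (simp add: chain_eval_superset[of "Poly_Mapping.keys c"] sum_distrib_left mult.assoc)
qed

lemma chain_eval_sum: "chain_eval \<phi> (\<Sum>i\<in>I. g i) = (\<Sum>i\<in>I. chain_eval \<phi> (g i))"
  by (induction I rule: infinite_finite_induct) (simp_all add: chain_eval_add)

lemma chain_eval_extend:
  "chain_eval \<phi> (frag_extend f c) = chain_eval (\<lambda>\<sigma>. chain_eval \<phi> (f \<sigma>)) c"
  by (simp add: frag_extend_def chain_eval_sum chain_eval_cmul) (simp add: chain_eval_def)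

lemma chain_eval_cong:
  assumes "\<And>\<sigma>. \<sigma> \<in> Poly_Mapping.keys c \<Longrightarrow> \<phi> \<sigma> = \<psi> \<sigma>"
  shows "chain_eval \<phi> c = chain_eval \<psi> c"
  using assms by (simp add: chain_eval_def)

lemma chain_eval_scale: "chain_eval (\<lambda>\<sigma>. k * \<phi> \<sigma>) c = k * chain_eval \<phi> c"
  by (simp add: chain_eval_def sum_distrib_left algebra_simps)

lemma chain_eval_minus: "chain_eval (\<lambda>\<sigma>. - \<phi> \<sigma>) c = - chain_eval \<phi> c"
  by (simp add: chain_eval_def sum_negf)

lemma chain_eval_Ints:
  assumes "\<And>\<sigma>. \<sigma> \<in> Poly_Mapping.keys c \<Longrightarrow> k * \<phi> \<sigma> \<in> \<int>"
  shows "k * chain_eval \<phi> c \<in> \<int>"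
proof -
  have "k * chain_eval \<phi> c
      = (\<Sum>\<sigma>\<in>Poly_Mapping.keys c. of_int (Poly_Mapping.lookup c \<sigma>) * (k * \<phi> \<sigma>))"
    by (simp add: chain_eval_def sum_distrib_left algebra_simps)
  also have "\<dots> \<in> \<int>"
    by (intro Ints_sum Ints_mult[OF Ints_of_int] assms)
  finally show ?thesis .
qed

section \<open>Vertices of simplices and the determinant cochain\<close>

lemma simplicial_vertex_in:
  assumes "singular_simplex d (subtopology (powertop_real UNIV) S) \<sigma>" "i \<le> d"
  shows "simplicial_vertex i \<sigma> \<in> S"
  using assms
  by (auto simp: singular_simplex_subtopology simplicial_vertex_def image_subset_iff)

lemma simplicial_vertex_singular_face:
  assumes "i \<le> n" "k \<le> Suc n"
  shows "simplicial_vertex i (singular_face (Suc n) k \<sigma>) = simplicial_vertex (skip k i) \<sigma>"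
proof -
  have "simplical_face k (\<lambda>j. if j = i then 1 else 0) = (\<lambda>j. if j = skip k i then 1 else 0 :: real)"
    by (auto simp: simplical_face_def skip_def fun_eq_iff)
  then show ?thesis
    using assms by (simp add: simplicial_vertex_def singular_face_def)
qed

lemma simplicial_vertex_simplex_map:
  assumes "i \<le> n"
  shows "simplicial_vertex i (simplex_map n g \<sigma>) = g (simplicial_vertex i \<sigma>)"
  using assms by (simp add: simplicial_vertex_def simplex_map_def)

text \<open>A cochain in dimension \<open>n - 1\<close>: the labels of the \<open>n\<close> vertices
  are the rows. Only vertices enter, so labels need not be continuous.\<close>

definition vertex_det :: "nat \<Rightarrow> ('a \<Rightarrow> nat \<Rightarrow> real) \<Rightarrow> ((nat \<Rightarrow> real) \<Rightarrow> 'a) \<Rightarrow> real" where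
  "vertex_det n w \<sigma> = mdet n (\<lambda>i. w (simplicial_vertex i \<sigma>))"

lemma vertex_det_singular_face:
  assumes "k \<le> Suc n"
  shows "vertex_det (Suc n) w (singular_face (Suc n) k \<sigma>)
    = mdet (Suc n) (\<lambda>r. w (simplicial_vertex (skip k r) \<sigma>))"
  unfolding vertex_det_def using assms
  by (intro mdet_cong) (simp add: simplicial_vertex_singular_face)

lemma vertex_det_simplex_map:
  "vertex_det (Suc n) w (simplex_map n g \<sigma>) = vertex_det (Suc n) (w \<circ> g) \<sigma>"
  unfolding vertex_det_def by (intro mdet_cong) (simp add: simplicial_vertex_simplex_map)

lemma chain_eval_chain_map:
  "chain_eval \<phi> (chain_map n g c) = chain_eval (\<lambda>\<sigma>. \<phi> (simplex_map n g \<sigma>)) c"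
  by (simp add: chain_map_def chain_eval_extend)

lemma chain_eval_chain_boundary:
  "chain_eval \<phi> (chain_boundary (Suc n) c)
    = chain_eval (\<lambda>\<sigma>. \<Sum>k\<le>Suc n. (-1) ^ k * \<phi> (singular_face (Suc n) k \<sigma>)) c"
  by (simp add: chain_boundary_def chain_eval_extend chain_eval_sum chain_eval_cmul
      chain_eval_add)

section \<open>Iterated barycentric subdivision of the standard simplex\<close>

abbreviation simplex_top :: "nat \<Rightarrow> (nat \<Rightarrow> real) topology" where
  "simplex_top d \<equiv> subtopology (powertop_real UNIV) (standard_simplex d)"

definition subdivided_simplex :: "nat \<Rightarrow> nat \<Rightarrow> (nat \<Rightarrow> real) chain" where
  "subdivided_simplex k d
    = (singular_subdivision d ^^ k) (frag_of (restrict id (standard_simplex d)))"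

lemma singular_simplex_id: "singular_simplex d (simplex_top d) (restrict id (standard_simplex d))"
  by (intro simplicial_imp_singular_simplex) simp

lemma singular_chain_subdivision_power:
  "singular_chain d X c \<Longrightarrow> singular_chain d X ((singular_subdivision d ^^ k) c)"
  by (induction k) (auto simp: singular_chain_singular_subdivision)

lemma singular_chain_subdivided_simplex: "singular_chain d (simplex_top d) (subdivided_simplex k d)"
  unfolding subdivided_simplex_def
  by (intro singular_chain_subdivision_power) (simp add: singular_chain_of singular_simplex_id)

lemma simplicial_vertex_subdivided_simplex:
  assumes "\<sigma> \<in> Poly_Mapping.keys (subdivided_simplex k d)" "i \<le> d"
  shows "simplicial_vertex i \<sigma> \<in> standard_simplex d"
  using singular_chain_subdivided_simplex[of d k] assms
  by (auto simp: singular_chain_def intro!: simplicial_vertex_in)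

lemma singular_subdivision_power_sum:
  assumes "finite I"
  shows "(singular_subdivision d ^^ k) (\<Sum>i\<in>I. frag_cmul (a i) (c i))
    = (\<Sum>i\<in>I. frag_cmul (a i) ((singular_subdivision d ^^ k) (c i)))"
proof (induction k)
  case (Suc k)
  show ?case
    using assms by (simp add: Suc) (simp add: singular_subdivision_def frag_extend_sum frag_extend_cmul)
qed simp

lemma singular_subdivision_power_chain_map:
  assumes "singular_chain d X c"
  shows "(singular_subdivision d ^^ k) (chain_map d g c)
    = chain_map d g ((singular_subdivision d ^^ k) c)"
  using assms
  by (induction k) (auto simp: naturality_singular_subdivision[OF singular_chain_subdivision_power])

lemma chain_boundary_subdivision_power:
  assumes "singular_chain (Suc d) X c"
  shows "chain_boundary (Suc d) ((singular_subdivision (Suc d) ^^ k) c)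
    = (singular_subdivision d ^^ k) (chain_boundary (Suc d) c)"
  using assms
  by (induction k) (auto simp: chain_boundary_singular_subdivision[OF singular_chain_subdivision_power])

text \<open>Subdivision is natural and commutes with the boundary operator, so each face carries a
  copy of the subdivided simplex of one dimension less.\<close>

lemma chain_boundary_subdivided_simplex:
  "chain_boundary (Suc d) (subdivided_simplex k (Suc d))
    = (\<Sum>i\<le>Suc d. frag_cmul ((-1) ^ i) (chain_map d (simplical_face i) (subdivided_simplex k d)))"
proof -
  let ?\<iota> = "\<lambda>d. restrict id (standard_simplex d) :: (nat \<Rightarrow> real) \<Rightarrow> nat \<Rightarrow> real"
  have face: "singular_face (Suc d) i id = simplex_map d (simplical_face i) (?\<iota> d)"
    if "i \<le> Suc d" for i
    using simplical_face_in_standard_simplex[of "Suc d" i] that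
    by (auto simp: singular_face_def simplex_map_def fun_eq_iff)
  have "chain_boundary (Suc d) (subdivided_simplex k (Suc d))
      = (singular_subdivision d ^^ k) (\<Sum>i\<le>Suc d. frag_cmul ((-1) ^ i)
          (chain_map d (simplical_face i) (frag_of (?\<iota> d))))"
    unfolding subdivided_simplex_def
    by (subst chain_boundary_subdivision_power[where X = "simplex_top (Suc d)"])
       (auto simp: singular_chain_of singular_simplex_id chain_boundary_of face simp del: sum.atMost_Suc)
  also have "\<dots> = (\<Sum>i\<le>Suc d. frag_cmul ((-1) ^ i)
      ((singular_subdivision d ^^ k) (chain_map d (simplical_face i) (frag_of (?\<iota> d)))))"
    by (rule singular_subdivision_power_sum) simp
  also have "\<dots> = (\<Sum>i\<le>Suc d. frag_cmul ((-1) ^ i)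
      (chain_map d (simplical_face i) (subdivided_simplex k d)))"
    unfolding subdivided_simplex_def
    by (subst singular_subdivision_power_chain_map[where X = "simplex_top d"])
       (auto simp: singular_chain_of singular_simplex_id)
  finally show ?thesis .
qed

text \<open>A discrete Stokes formula: the left side pairs the coboundary of
  \<open>vertex_det\<close> with the subdivision; interior faces cancel in the boundary
  chain.\<close>

lemma stokes_subdivided_simplex:
  "chain_eval (\<lambda>\<sigma>. \<Sum>k\<le>Suc d. (-1) ^ k * mdet (Suc d) (\<lambda>r. w (simplicial_vertex (skip k r) \<sigma>)))
      (subdivided_simplex K (Suc d))
    = (\<Sum>i\<le>Suc d. (-1) ^ i * chain_eval (vertex_det (Suc d) (w \<circ> simplical_face i)) (subdivided_simplex K d))"
proof -
  have "chain_eval (\<lambda>\<sigma>. \<Sum>k\<le>Suc d. (-1) ^ k * mdet (Suc d) (\<lambda>r. w (simplicial_vertex (skip k r) \<sigma>)))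
      (subdivided_simplex K (Suc d))
    = chain_eval (\<lambda>\<sigma>. \<Sum>k\<le>Suc d. (-1) ^ k * vertex_det (Suc d) w (singular_face (Suc d) k \<sigma>))
      (subdivided_simplex K (Suc d))"
    by (intro chain_eval_cong sum.cong refl) (simp add: vertex_det_singular_face)
  also have "\<dots> = chain_eval (vertex_det (Suc d) w)
      (chain_boundary (Suc d) (subdivided_simplex K (Suc d)))"
    by (rule chain_eval_chain_boundary[symmetric])
  also have "\<dots> = (\<Sum>i\<le>Suc d. (-1) ^ i * chain_eval (vertex_det (Suc d) (w \<circ> simplical_face i)) (subdivided_simplex K d))"
    by (simp add: chain_boundary_subdivided_simplex chain_eval_sum chain_eval_cmul chain_eval_add
        chain_eval_chain_map vertex_det_simplex_map del: sum.atMost_Suc)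
  finally show ?thesis .
qed

lemma subdivided_simplex_0: "subdivided_simplex k 0 = frag_of (restrict id (standard_simplex 0))"
proof (induction k)
  case (Suc k)
  have "subdivided_simplex (Suc k) 0 = singular_subdivision 0 (subdivided_simplex k 0)"
    by (simp add: subdivided_simplex_def)
  also have "\<dots> = subdivided_simplex k 0"
    by (rule singular_subdivision_zero[OF singular_chain_subdivided_simplex])
  finally show ?case
    by (simp only: Suc)
qed (simp only: subdivided_simplex_def funpow_0)

text \<open>Sperner's lemma with fractional labels, by induction: \<open>mdet_affine_rows\<close>
  and Stokes reduce dimension \<open>Suc d\<close> to its faces. On face \<open>i\<close> with
  \<open>i \<le> d\<close> the labels have a zero column \<open>i\<close>, so only the last face
  counts, and there the labels are again of Sperner type.\<close>

lemma sperner_subdivided_simplex: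
  assumes "\<And>s. s \<in> standard_simplex d \<Longrightarrow> (\<Sum>i\<le>d. w s i) = 1"
    and "\<And>s i. s \<in> standard_simplex d \<Longrightarrow> i \<le> d \<Longrightarrow> s i = 0 \<Longrightarrow> w s i = 0"
  shows "chain_eval (vertex_det (Suc d) w) (subdivided_simplex k d) = 1"
  using assms
proof (induction d arbitrary: w)
  case 0
  have "w (\<lambda>j. if j = 0 then 1 else 0) 0 = 1"
    using 0(1)[of "\<lambda>j. if j = 0 then 1 else 0"] by simp
  then show ?case
    by (simp add: subdivided_simplex_0 vertex_det_def mdet_expand_last simplicial_vertex_def)
next
  case (Suc d)
  have face: "simplical_face i s \<in> standard_simplex (Suc d)" if "i \<le> Suc d" "s \<in> standard_simplex d" for i s
    using simplical_face_in_standard_simplex[of "Suc d" i s] that by simp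
  have "chain_eval (vertex_det (Suc (Suc d)) w) (subdivided_simplex k (Suc d))
      = (-1) ^ Suc d * chain_eval (\<lambda>\<sigma>. \<Sum>k\<le>Suc d. (-1) ^ k *
          mdet (Suc d) (\<lambda>r. w (simplicial_vertex (skip k r) \<sigma>))) (subdivided_simplex k (Suc d))"
    unfolding chain_eval_scale[symmetric] vertex_det_def
    by (intro chain_eval_cong mdet_affine_rows Suc.prems(1) simplicial_vertex_subdivided_simplex)
  also have "\<dots> = (-1) ^ Suc d * (\<Sum>i\<le>Suc d. (-1) ^ i *
      chain_eval (vertex_det (Suc d) (w \<circ> simplical_face i)) (subdivided_simplex k d))"
    by (simp only: stokes_subdivided_simplex)
  also have "(\<Sum>i\<le>Suc d. (-1) ^ i *
        chain_eval (vertex_det (Suc d) (w \<circ> simplical_face i)) (subdivided_simplex k d))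
      = (\<Sum>i\<in>{Suc d}. (-1) ^ i *
        chain_eval (vertex_det (Suc d) (w \<circ> simplical_face i)) (subdivided_simplex k d))"
  proof (rule sum.mono_neutral_right)
    show "\<forall>i\<in>{..Suc d} - {Suc d}. (-1) ^ i *
        chain_eval (vertex_det (Suc d) (w \<circ> simplical_face i)) (subdivided_simplex k d) = 0"
    proof
      fix i assume i: "i \<in> {..Suc d} - {Suc d}"
      have "chain_eval (vertex_det (Suc d) (w \<circ> simplical_face i)) (subdivided_simplex k d)
          = chain_eval (\<lambda>_. 0) (subdivided_simplex k d)"
        unfolding vertex_det_def
      proof (intro chain_eval_cong mdet_zero_column[of i])
        fix \<sigma> j assume "\<sigma> \<in> Poly_Mapping.keys (subdivided_simplex k d)" "j < Suc d"
        then have "simplical_face i (simplicial_vertex j \<sigma>) \<in> standard_simplex (Suc d)"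
          using i by (intro face simplicial_vertex_subdivided_simplex) auto
        then show "(w \<circ> simplical_face i) (simplicial_vertex j \<sigma>) i = 0"
          using i by (auto simp: simplical_face_def intro!: Suc.prems(2))
      qed (use i in auto)
      then show "(-1) ^ i *
        chain_eval (vertex_det (Suc d) (w \<circ> simplical_face i)) (subdivided_simplex k d) = 0"
        by (simp add: chain_eval_def)
    qed
  qed auto
  also have "(-1) ^ Suc d * (\<Sum>i\<in>{Suc d}. (-1) ^ i *
        chain_eval (vertex_det (Suc d) (w \<circ> simplical_face i)) (subdivided_simplex k d))
      = chain_eval (vertex_det (Suc d) (w \<circ> simplical_face (Suc d))) (subdivided_simplex k d)"
    by (simp add: mult.assoc[symmetric] power_add[symmetric] flip: mult_2)
  also have "\<dots> = 1"
  proof (rule Suc.IH)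
    fix s assume s: "s \<in> standard_simplex d"
    have "w (simplical_face (Suc d) s) (Suc d) = 0"
      using s by (intro Suc.prems(2) face) (auto simp: simplical_face_def)
    then show "(\<Sum>i\<le>d. (w \<circ> simplical_face (Suc d)) s i) = 1"
      using Suc.prems(1)[OF face[OF order_refl s]] by simp
    fix i assume "i \<le> d" "s i = 0"
    then show "(w \<circ> simplical_face (Suc d)) s i = 0"
      unfolding comp_apply by (intro Suc.prems(2) face[OF order_refl s]) (auto simp: simplical_face_def)
  qed
  finally show ?case .
qed

text \<open>The hypothesis on neighbourhoods says that one of the \<open>p + 1\<close> labels is missing near each point,
  the label \<open>p\<close> having weight \<open>1 - (\<Sum>j<p. u t j)\<close>. In the standard simplex of dimension \<open>p\<close>, the
  coordinate \<open>p\<close> plays a special role: the face where it vanishes is labelled as in Sperner's lemma, and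
  the other faces are related by the permutations of the remaining coordinates.\<close>

lemma no_symmetric_labelling:
  fixes u :: "(nat \<Rightarrow> real) \<Rightarrow> nat \<Rightarrow> real" and c :: nat
  assumes "prime p" "\<not> p dvd c"
    and local: "\<And>s. s \<in> standard_simplex p \<Longrightarrow> \<exists>U. openin (simplex_top p) U \<and> s \<in> U \<and>
          ((\<exists>j<p. \<forall>t\<in>U. u t j = 0) \<or> (\<forall>t\<in>U. (\<Sum>j<p. u t j) = 1))"
    and int: "\<And>s j. s \<in> standard_simplex p \<Longrightarrow> j < p \<Longrightarrow> c * u s j \<in> \<int>"
    and swap: "\<And>s i j. s \<in> standard_simplex (p - 1) \<Longrightarrow> Suc i < p \<Longrightarrow> j < p \<Longrightarrow>
          u (simplical_face (Suc i) s) j = u (simplical_face i s) (Transposition.transpose i (Suc i) j)"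
    and top_sum: "\<And>s. s \<in> standard_simplex (p - 1) \<Longrightarrow> (\<Sum>j<p. u (simplical_face p s) j) = 1"
    and top_zero: "\<And>s j. s \<in> standard_simplex (p - 1) \<Longrightarrow> j < p \<Longrightarrow> s j = 0 \<Longrightarrow>
          u (simplical_face p s) j = 0"
  shows False
proof -
  obtain n where p: "p = Suc n"
    using \<open>prime p\<close> by (metis not0_implies_Suc not_prime_0)
  define \<C> where "\<C> = {U. openin (simplex_top p) U \<and>
          ((\<exists>j<p. \<forall>t\<in>U. u t j = 0) \<or> (\<forall>t\<in>U. (\<Sum>j<p. u t j) = 1))}"
  have "topspace (simplex_top p) \<subseteq> \<Union>\<C>"
    using local by (fastforce simp: \<C>_def)
  moreover have "singular_chain p (simplex_top p) (frag_of (restrict id (standard_simplex p)))"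
    unfolding singular_chain_of by (rule singular_simplex_id)
  moreover have "openin (simplex_top p) U" if "U \<in> \<C>" for U
    using that by (simp add: \<C>_def)
  \<comment> \<open>Subdivide until each small simplex lies in one member of the cover: its labels
    then share a zero coordinate or all have sum 1.\<close>
  ultimately obtain K where K: "\<And>m f. \<lbrakk>K \<le> m; f \<in> Poly_Mapping.keys ((singular_subdivision p ^^ m)
      (frag_of (restrict id (standard_simplex p))))\<rbrakk> \<Longrightarrow> \<exists>V\<in>\<C>. f \<in> standard_simplex p \<rightarrow> V"
    using sufficient_iterated_singular_subdivision_exists[of \<C> "simplex_top p" p
        "frag_of (restrict id (standard_simplex p))"] by metis
  define e where "e i = chain_eval (vertex_det p (u \<circ> simplical_face i)) (subdivided_simplex K n)" for i
  have "(\<Sum>i\<le>p. (-1) ^ i * e i) = chain_eval (\<lambda>\<sigma>. \<Sum>k\<le>p. (-1) ^ k *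
      mdet p (\<lambda>r. u (simplicial_vertex (skip k r) \<sigma>))) (subdivided_simplex K p)"
    unfolding e_def p by (rule stokes_subdivided_simplex[symmetric])
  also have "\<dots> = chain_eval (\<lambda>_. 0) (subdivided_simplex K p)"
  proof (intro chain_eval_cong)
    fix \<sigma> assume \<sigma>: "\<sigma> \<in> Poly_Mapping.keys (subdivided_simplex K p)"
    then obtain V where V: "V \<in> \<C>" "\<sigma> \<in> standard_simplex p \<rightarrow> V"
      using K[of K \<sigma>] by (auto simp: subdivided_simplex_def)
    have vV: "simplicial_vertex i \<sigma> \<in> V" if "i \<le> p" for i
      using V that by (auto simp: simplicial_vertex_def)
    consider j where "j < p" "\<forall>t\<in>V. u t j = 0" | "\<forall>t\<in>V. (\<Sum>j<p. u t j) = 1"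
      using V by (auto simp: \<C>_def)
    then show "(\<Sum>k\<le>p. (-1) ^ k * mdet p (\<lambda>r. u (simplicial_vertex (skip k r) \<sigma>))) = 0"
    proof cases
      case 1
      then show ?thesis
        using vV by (intro alternating_minors_zero_column[of j p "\<lambda>i. u (simplicial_vertex i \<sigma>)"]) auto
    next
      case 2
      then show ?thesis
        using vV by (intro alternating_minors_affine[of p "\<lambda>i. u (simplicial_vertex i \<sigma>)"]) auto
    qed
  qed
  finally have sum0: "(\<Sum>i<p. (-1) ^ i * e i) + (-1) ^ p * e p = 0"
    by (simp add: chain_eval_def lessThan_Suc_atMost[symmetric])
  have "e p = 1"
    unfolding e_def p
  proof (rule sperner_subdivided_simplex)
    fix s assume s: "s \<in> standard_simplex n"
    show "(\<Sum>i\<le>n. (u \<circ> simplical_face (Suc n)) s i) = 1"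
      using top_sum[of s] s by (simp add: p lessThan_Suc_atMost)
    fix i assume "i \<le> n" "s i = 0"
    then show "(u \<circ> simplical_face (Suc n)) s i = 0"
      using top_zero[of s i] s by (simp add: p)
  qed
  \<comment> \<open>Labels on adjacent faces differ by exchanging two columns; this sign change
    makes up for the alternating sign in the boundary, so the first \<open>p\<close> faces add up to
    \<open>p * e 0\<close>.\<close>
  have step: "e (Suc i) = - e i" if "Suc i < p" for i
  proof -
    have "e (Suc i) = chain_eval (\<lambda>\<sigma>. - vertex_det p (u \<circ> simplical_face i) \<sigma>) (subdivided_simplex K n)"
      unfolding e_def
    proof (rule chain_eval_cong)
      fix \<sigma> assume \<sigma>: "\<sigma> \<in> Poly_Mapping.keys (subdivided_simplex K n)"
      have "vertex_det p (u \<circ> simplical_face (Suc i)) \<sigma>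
          = mdet p (\<lambda>r j. u (simplical_face i (simplicial_vertex r \<sigma>)) (Transposition.transpose i (Suc i) j))"
        unfolding vertex_det_def
        using \<sigma> that by (intro mdet_cong) (simp add: swap simplicial_vertex_subdivided_simplex p)
      also have "\<dots> = - vertex_det p (u \<circ> simplical_face i) \<sigma>"
        unfolding vertex_det_def using that
        by (subst mdet_swap_columns) auto
      finally show "vertex_det p (u \<circ> simplical_face (Suc i)) \<sigma> = - vertex_det p (u \<circ> simplical_face i) \<sigma>" .
    qed
    then show ?thesis
      by (simp add: chain_eval_minus e_def)
  qed
  have "(-1) ^ i * e i = e 0" if "i < p" for i
    using that by (induction i) (auto simp: step)
  then have "p * e 0 = - ((-1) ^ p)"
    using sum0 \<open>e p = 1\<close> by simp
  then have abs: "\<bar>p * e 0\<bar> = 1" by (simp add: power_abs)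
  \<comment> \<open>Entries with denominator dividing \<open>c\<close> give a determinant with
    denominator dividing \<open>c ^ p\<close>; as \<open>p * e 0\<close> has absolute value 1,
    \<open>p\<close> must divide \<open>c ^ p\<close>.\<close>
  have "real c ^ p * e 0 \<in> \<int>"
    unfolding e_def
  proof (rule chain_eval_Ints)
    fix \<sigma> assume \<sigma>: "\<sigma> \<in> Poly_Mapping.keys (subdivided_simplex K n)"
    show "real c ^ p * vertex_det p (u \<circ> simplical_face 0) \<sigma> \<in> \<int>"
      unfolding vertex_det_def
    proof (rule mdet_Ints)
      fix i j assume "i < p" "j < p"
      then have "simplicial_vertex i \<sigma> \<in> standard_simplex n"
        using \<sigma> by (intro simplicial_vertex_subdivided_simplex) (auto simp: p)
      then have "simplical_face 0 (simplicial_vertex i \<sigma>) \<in> standard_simplex p"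
        using simplical_face_in_standard_simplex[of p 0] by (simp add: p)
      then show "real c * (u \<circ> simplical_face 0) (simplicial_vertex i \<sigma>) j \<in> \<int>"
        using int \<open>j < p\<close> by simp
    qed
  qed
  then obtain z where z: "real c ^ p * e 0 = of_int z"
    by (auto elim: Ints_cases)
  have "real_of_int \<bar>int p * z\<bar> = real c ^ p * \<bar>p * e 0\<bar>"
    by (simp add: z[symmetric] abs_mult)
  also have "\<dots> = real_of_int (int (c ^ p))"
    by (simp add: abs)
  finally have "\<bar>int p * z\<bar> = int (c ^ p)"
    by (simp only: of_int_eq_iff)
  then have "int p dvd int (c ^ p)"
    by (metis dvd_abs_iff dvd_triv_left)
  then have "p dvd c ^ p"
    by (simp only: int_dvd_int_iff)
  then show False
    using \<open>prime p\<close> \<open>\<not> p dvd c\<close> prime_dvd_power by blast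
qed

section \<open>Labels of partitions\<close>

text \<open>A partition of \<open>[a, b]\<close> is given by its relative lengths \<open>t 0, t 1, \<dots>\<close>.\<close>

definition piece :: "(real \<times> real \<times> real \<Rightarrow> real) \<Rightarrow> real \<times> real \<times> real \<Rightarrow> (nat \<Rightarrow> real) \<Rightarrow> nat \<Rightarrow> real" where
  "piece F = (\<lambda>(a, b, y) t i. F (a + (\<Sum>l<i. t l) * (b - a), a + (\<Sum>l<Suc i. t l) * (b - a), y))"

text \<open>No order of \<open>a\<close> and \<open>b\<close> is demanded, so this is a subset of
  the whole space. The simplex of dimension \<open>p - 1\<close> has \<open>p\<close> coordinates,
  one per piece.\<close>

definition equipartitions :: "(real \<times> real \<times> real \<Rightarrow> real) \<Rightarrow> nat \<Rightarrow> (real \<times> real \<times> real) set" where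
  "equipartitions F p = {q. \<exists>t\<in>standard_simplex (p - 1). \<forall>i<p. piece F q t i = 0}"

lemma piece_degenerate: "t i = 0 \<Longrightarrow> \<exists>x. piece F (a, b, y) t i = F (x, x, y)"
  by (auto simp: piece_def)

lemma partial_sum_swap:
  fixes t :: "nat \<Rightarrow> real"
  shows "(\<Sum>l<j. t (Transposition.transpose i (Suc i) l))
    = (if j = Suc i then (\<Sum>l<i. t l) + t (Suc i) else (\<Sum>l<j. t l))"
  by (induction j) (auto simp: Transposition.transpose_def)

text \<open>Moving the empty piece \<open>i\<close> past its right neighbour leaves the other pieces
  in place, only renumbered. Index \<open>Suc i\<close> is excluded: it is the moved empty piece,
  now located at another point.\<close>

lemma piece_swap:
  assumes "t i = 0" "j \<noteq> Suc i"
  shows "piece F q (t \<circ> Transposition.transpose i (Suc i)) j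
    = piece F q t (Transposition.transpose i (Suc i) j)"
proof -
  let ?\<tau> = "Transposition.transpose i (Suc i)"
  have "(\<Sum>l<j. (t \<circ> ?\<tau>) l) = (\<Sum>l<?\<tau> j. t l)" "(\<Sum>l<Suc j. (t \<circ> ?\<tau>) l) = (\<Sum>l<Suc (?\<tau> j). t l)"
    unfolding comp_apply partial_sum_swap using assms by (auto simp: Transposition.transpose_def)
  then show ?thesis
    by (cases q) (simp add: piece_def del: sum.lessThan_Suc)
qed

lemma simplical_face_Suc:
  "simplical_face (Suc i) s = simplical_face i s \<circ> Transposition.transpose i (Suc i)"
  by (auto simp: simplical_face_def fun_eq_iff Transposition.transpose_def)

text \<open>\<open>K\<close> is the set of nondegenerate pieces, \<open>A\<close> the set of those with nonnegative value, and \<open>P\<close> says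
  that the value on degenerate pieces is nonnegative. Using the least element of \<open>A\<close>, and otherwise
  all degenerate pieces with equal weight, makes the label independent of where degenerate pieces
  are inserted. If \<open>K = {..<p}\<close> and \<open>A = {}\<close>, the label is zero whatever \<open>P\<close> is.\<close>

definition label :: "nat \<Rightarrow> nat set \<Rightarrow> nat set \<Rightarrow> bool \<Rightarrow> nat \<Rightarrow> real" where
  "label p K A P j = (if A \<noteq> {} then of_bool (j = Min A)
     else if P \<and> j \<notin> K then 1 / real (p - card K) else 0)"

text \<open>On \<open>K\<close> the transposition preserves order, because \<open>Suc i\<close>
  moves to the free place \<open>i\<close>; hence it maps the least element of \<open>A\<close> to
  the least element of the image. The equal weights outside \<open>K\<close> are symmetric
  anyway.\<close>

lemma label_swap:
  assumes "finite A" "A \<subseteq> K" "i \<notin> K" "j < p"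
  defines "\<tau> \<equiv> Transposition.transpose i (Suc i)"
  shows "label p (\<tau> ` K) (\<tau> ` A) P j = label p K A P (\<tau> j)"
proof -
  have tt: "\<tau> (\<tau> x) = x" for x by (simp add: \<tau>_def)
  have inj: "inj \<tau>" by (simp add: \<tau>_def)
  have 1: "j \<in> \<tau> ` K \<longleftrightarrow> \<tau> j \<in> K"
    by (metis tt image_iff)
  have 2: "card (\<tau> ` K) = card K"
    using inj by (simp add: card_image inj_on_subset)
  have 3: "j = Min (\<tau> ` A) \<longleftrightarrow> \<tau> j = Min A" if "A \<noteq> {}"
  proof -
    have "Min (\<tau> ` A) = \<tau> (Min A)"
    proof (rule Min_eqI)
      show "finite (\<tau> ` A)" "\<tau> (Min A) \<in> \<tau> ` A"
        using assms that by auto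
      fix y assume "y \<in> \<tau> ` A"
      then obtain x where x: "x \<in> A" "y = \<tau> x" by auto
      then have "Min A \<le> x" "x \<noteq> i" "Min A \<noteq> i"
        using assms that by (auto dest: Min_in)
      then show "\<tau> (Min A) \<le> y"
        using x by (auto simp: \<tau>_def Transposition.transpose_def)
    qed
    then show ?thesis by (metis tt)
  qed
  show ?thesis
    by (cases "A = {}") (simp_all add: label_def 1 2 3)
qed

lemma label_sum:
  assumes "K \<subseteq> {..<p}" "A \<subseteq> K" "A \<noteq> {} \<or> P \<and> K \<noteq> {..<p}"
  shows "(\<Sum>j<p. label p K A P j) = 1"
proof (cases "A = {}")
  case False
  have "finite A"
    using assms finite_subset by (metis finite_lessThan)
  then have "Min A < p"
    using False assms Min_in by blast
  then show ?thesis
    using False by (simp add: label_def of_bool_def)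
next
  case True
  then have P: P and K: "K \<noteq> {..<p}" using assms by auto
  have "finite K" using assms finite_subset by blast
  have "card K < p"
    using psubset_card_mono[of "{..<p}" K] assms K by auto
  have "(\<Sum>j<p. label p K A P j) = (\<Sum>j\<in>{..<p} - K. 1 / real (p - card K))"
    using True P by (intro sum.mono_neutral_cong_right) (auto simp: label_def)
  also have "\<dots> = 1"
    using assms \<open>finite K\<close> \<open>card K < p\<close> by (simp add: card_Diff_subset)
  finally show ?thesis .
qed

text \<open>For nonempty \<open>K\<close> the only possible denominator \<open>p - card K\<close> is
  at most \<open>p - 1\<close>, hence divides the factorial.\<close>

lemma label_Ints:
  assumes "K \<subseteq> {..<p}" "P \<Longrightarrow> K \<noteq> {}"
  shows "fact (p - 1) * label p K A P j \<in> \<int>"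
proof (cases "A = {} \<and> P \<and> card K < p")
  case True
  then have "card K > 0"
    using assms finite_subset by (fastforce simp: card_gt_0_iff)
  then have "p - card K dvd fact (p - 1)"
    using True by (intro dvd_fact) auto
  then obtain k where "fact (p - 1) = (p - card K) * k" by (auto elim: dvdE)
  then have "(fact (p - 1) :: real) = real (p - card K) * real k"
    by (metis of_nat_fact of_nat_mult)
  then show ?thesis
    using True by (auto simp: label_def)
qed (auto simp: label_def fact_in_Ints)

text \<open>For \<open>s p = 1\<close> division by zero makes this the zero function, whose partial sums still lie in
  the unit interval.\<close>

definition rescale :: "nat \<Rightarrow> (nat \<Rightarrow> real) \<Rightarrow> nat \<Rightarrow> real" where
  "rescale p s l = (if l < p then s l / (1 - s p) else 0)"

text \<open>The \<open>p\<close>-simplex is viewed as a cone over the simplex of partitions: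
  \<open>1 - s p\<close> will be the path parameter, and the other coordinates, divided by their
  sum, are the partition. The apex \<open>s p = 1\<close> has no partition.\<close>

lemma rescale_in_simplex:
  assumes "s \<in> standard_simplex p" "s p \<noteq> 1" "p > 0"
  shows "rescale p s \<in> standard_simplex (p - 1)"
proof -
  have s: "0 \<le> s i" "s i \<le> 1" for i
    using assms by (auto simp: standard_simplex_def)
  have "sum s {..p} = 1" using assms by (auto simp: standard_simplex_def)
  then have sum: "(\<Sum>l<p. s l) = 1 - s p"
    by (simp flip: lessThan_Suc_atMost)
  have "s p < 1" using s[of p] assms by simp
  have "s l \<le> 1 - s p" if "l < p" for l
    using member_le_sum[of l "{..<p}" s] that s sum by simp
  moreover have "(\<Sum>l\<le>p - 1. rescale p s l) = (\<Sum>l<p. s l / (1 - s p))"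
    using assms by (intro sum.cong) (auto simp: rescale_def)
  moreover have "\<dots> = 1"
    using \<open>s p < 1\<close> by (simp add: sum flip: sum_divide_distrib)
  ultimately show ?thesis
    using s \<open>s p < 1\<close> assms by (auto simp: standard_simplex_def rescale_def)
qed

lemma partial_sum_simplex:
  assumes "t \<in> standard_simplex n"
  shows "0 \<le> (\<Sum>l<i. t l)" "(\<Sum>l<i. t l) \<le> 1"
proof -
  have t: "0 \<le> t l" for l using assms by (auto simp: standard_simplex_def)
  then show "0 \<le> (\<Sum>l<i. t l)" by (simp add: sum_nonneg)
  have "(\<Sum>l<i. t l) \<le> (\<Sum>l\<in>{..<i} \<union> {..n}. t l)"
    using t by (intro sum_mono2) auto
  also have "\<dots> = (\<Sum>l\<le>n. t l)"
    using assms by (intro sum.mono_neutral_right) (auto simp: standard_simplex_def)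
  also have "\<dots> = 1" using assms by (simp add: standard_simplex_def)
  finally show "(\<Sum>l<i. t l) \<le> 1" .
qed

lemma rescale_partial_sum:
  assumes "s \<in> standard_simplex p" "p > 0"
  shows "0 \<le> (\<Sum>l<i. rescale p s l)" "(\<Sum>l<i. rescale p s l) \<le> 1"
proof -
  have "0 \<le> (\<Sum>l<i. rescale p s l) \<and> (\<Sum>l<i. rescale p s l) \<le> 1"
  proof (cases "s p = 1")
    case True
    then have "rescale p s = (\<lambda>_. 0)" by (auto simp: rescale_def)
    then show ?thesis by simp
  next
    case False
    then show ?thesis using partial_sum_simplex[OF rescale_in_simplex[OF assms(1) False assms(2)]] by blast
  qed
  then show "0 \<le> (\<Sum>l<i. rescale p s l)" "(\<Sum>l<i. rescale p s l) \<le> 1" by auto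
qed

text \<open>The bound is uniform in the partition, which handles the apex of the cone, where
  \<open>rescale\<close> is discontinuous.\<close>

lemma piece_negative:
  assumes "continuous_on UNIV F" "F (0, 0, -1) < 0"
  obtains e where "e > 0" "\<And>a b y t i. \<bar>a\<bar> < e \<Longrightarrow> \<bar>b\<bar> < e \<Longrightarrow> \<bar>y + 1\<bar> < e \<Longrightarrow>
      (\<And>i. 0 \<le> (\<Sum>l<i. t l)) \<Longrightarrow> (\<And>i. (\<Sum>l<i. t l) \<le> 1) \<Longrightarrow> piece F (a, b, y) t i < 0"
proof -
  have "open {q. F q < 0}"
    using assms(1) by (intro open_Collect_less) (auto intro!: continuous_intros)
  then obtain d where d: "d > 0" "ball (0, 0, -1) d \<subseteq> {q. F q < 0}"
    using assms(2) open_contains_ball by (metis mem_Collect_eq)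
  show thesis
  proof (rule that[of "d / 3"])
    show "d / 3 > 0" using d by simp
    fix a b y :: real and t :: "nat \<Rightarrow> real" and i
    assume ab: "\<bar>a\<bar> < d / 3" "\<bar>b\<bar> < d / 3" "\<bar>y + 1\<bar> < d / 3"
      and t: "\<And>i. 0 \<le> (\<Sum>l<i. t l)" "\<And>i. (\<Sum>l<i. t l) \<le> 1"
    have small: "\<bar>a + r * (b - a)\<bar> < d / 3" if "0 \<le> r" "r \<le> 1" for r
    proof -
      have "a + r * (b - a) = (1 - r) *\<^sub>R a + r *\<^sub>R b" by (simp add: algebra_simps)
      also have "\<dots> \<in> ball 0 (d / 3)"
        using ab that by (intro convexD[OF convex_ball]) auto
      finally show ?thesis by simp
    qed
    let ?x = "a + (\<Sum>l<i. t l) * (b - a)" and ?z = "a + (\<Sum>l<Suc i. t l) * (b - a)"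
    have "dist (0, 0, -1) (?x, ?z, y) \<le> \<bar>?x\<bar> + (\<bar>?z\<bar> + \<bar>y + 1\<bar>)"
    proof -
      have "norm (?x, ?z, y + 1) \<le> norm ?x + norm (?z, y + 1)" by (rule norm_Pair_le)
      also have "norm (?z, y + 1) \<le> norm ?z + norm (y + 1)" by (rule norm_Pair_le)
      finally show ?thesis
        by (subst dist_commute) (simp add: dist_norm del: sum.lessThan_Suc)
    qed
    also have "\<dots> < d"
      using small[OF t(1)[of i] t(2)[of i]] small[OF t(1)[of "Suc i"] t(2)[of "Suc i"]] ab by linarith
    finally show "piece F (a, b, y) t i < 0"
      using d by (auto simp: piece_def)
  qed
qed

section \<open>Paths from bottom to top meet the equipartitions\<close>

lemma continuous_on_coordinate: "continuous_on S (\<lambda>s :: nat \<Rightarrow> real. s l)"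
  using continuous_on_product_coordinates by (rule continuous_on_subset) simp

lemma continuous_on_piece_rescale:
  fixes F :: "real \<times> real \<times> real \<Rightarrow> real"
  assumes F: "continuous_on UNIV F" and c: "continuous_on {0..1} c" and i: "i < p"
  shows "continuous_on {s \<in> standard_simplex p. s p \<noteq> 1} (\<lambda>s. piece F (c (1 - s p)) (rescale p s) i)"
proof -
  let ?W = "{s \<in> standard_simplex p. s p \<noteq> 1}"
  have coord: "continuous_on ?W (\<lambda>s. s l)" for l
    by (rule continuous_on_coordinate)
  have "continuous_on ?W (\<lambda>s. c (1 - s p))"
    by (rule continuous_on_compose2[OF c]) (auto intro!: continuous_intros continuous_on_coordinate simp: standard_simplex_def)
  moreover have "continuous_on ?W (\<lambda>s. rescale p s l)" for l
    unfolding rescale_def by (cases "l < p") (auto intro!: continuous_intros coord)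
  ultimately show ?thesis
    unfolding piece_def case_prod_unfold
    by (intro continuous_on_compose2[OF F]) (auto intro!: continuous_intros)
qed

lemma equipartitions_meet_path:
  fixes F :: "real \<times> real \<times> real \<Rightarrow> real" and c :: "real \<Rightarrow> real \<times> real \<times> real"
  assumes p: "prime p" and F: "continuous_on UNIV F" and diag: "\<And>a y. sgn (F (a, a, y)) = sgn y"
    and c: "continuous_on {0..1} c" "c 0 = (0, 0, -1)" "c 1 = (0, 0, 1)"
  shows "\<exists>\<tau>\<in>{0..1}. c \<tau> \<in> equipartitions F p"
proof (rule ccontr)
  assume *: "\<not> (\<exists>\<tau>\<in>{0..1}. c \<tau> \<in> equipartitions F p)"
  have "p > 0" using p prime_gt_0_nat by blast
  have sgn_iff: "F (a, a, y) > 0 \<longleftrightarrow> y > 0" "F (a, a, y) < 0 \<longleftrightarrow> y < 0" "F (a, a, y) \<ge> 0 \<longleftrightarrow> y \<ge> 0" for a y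
    using diag[of a y] by (auto simp: sgn_if split: if_splits)
  define K where "K s = {i. i < p \<and> s i \<noteq> 0}" for s :: "nat \<Rightarrow> real"
  define H where "H s i = piece F (c (1 - s p)) (rescale p s) i" for s i
  define A where "A s = {i \<in> K s. H s i \<ge> 0}" for s
  define P where "P s \<longleftrightarrow> snd (snd (c (1 - s p))) \<ge> 0" for s :: "nat \<Rightarrow> real"
  define u where "u s = label p (K s) (A s) (P s)" for s
  have K: "K s \<subseteq> {..<p}" "A s \<subseteq> K s" "finite (A s)" for s
    by (auto simp: K_def A_def)
  have top: "simplex_top p = top_of_set (standard_simplex p)"
    by (simp add: euclidean_product_topology)
  have s_bounds: "0 \<le> s i" "s i \<le> 1" if "s \<in> standard_simplex p" for s i
    using that by (auto simp: standard_simplex_def)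
  \<comment> \<open>By \<open>diag\<close> the sign on an empty piece depends only on the height
    \<open>y\<close>, not on where the piece lies.\<close>
  have degenerate: "H s i \<ge> 0 \<longleftrightarrow> P s" if "i < p" "i \<notin> K s" for s i
  proof -
    have "rescale p s i = 0" using that by (auto simp: K_def rescale_def)
    then show ?thesis
      unfolding H_def P_def using piece_degenerate[of "rescale p s" i F] sgn_iff(3)
      by (cases "c (1 - s p)") (metis snd_conv)
  qed
  have u_zero: "u s i = 0" if "i < p" "H s i < 0" for s i
  proof -
    have "i \<notin> A s" using that by (auto simp: A_def)
    then have "i \<noteq> Min (A s)" if "A s \<noteq> {}" using that K(3) Min_in by metis
    moreover have "\<not> (P s \<and> i \<notin> K s)" using degenerate[of i s] that by auto
    ultimately show ?thesis by (auto simp: u_def label_def)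
  qed
  have sum_one: "(\<Sum>j<p. u s j) = 1" if "i < p" "H s i \<ge> 0" for s i
    unfolding u_def
  proof (rule label_sum)
    show "A s \<noteq> {} \<or> P s \<and> K s \<noteq> {..<p}"
      using that degenerate[of i s] by (cases "i \<in> K s") (auto simp: A_def)
  qed (rule K)+
  show False
  proof (rule no_symmetric_labelling[OF p, of "fact (p - 1)" u])
    show "\<not> p dvd fact (p - 1)"
      using p \<open>p > 0\<close> by (simp add: prime_dvd_fact_iff)
  next
    fix s j assume s: "s \<in> standard_simplex p" and "j < p"
    \<comment> \<open>\<open>K s\<close> is empty only at the apex, where the path has height -1 and
      \<open>P s\<close> fails.\<close>
    have "K s \<noteq> {}" if "P s"
    proof
      assume "K s = {}"
      then have "(\<Sum>l<p. s l) = 0" by (auto simp: K_def)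
      moreover have "sum s {..p} = 1" using s by (auto simp: standard_simplex_def)
      ultimately have "s p = 1" by (simp flip: lessThan_Suc_atMost)
      then show False using that c by (simp add: P_def)
    qed
    then show "real (fact (p - 1)) * u s j \<in> \<int>"
      using label_Ints[OF K(1), of "P s" s "A s" j] by (simp add: u_def)
  next
    fix s :: "nat \<Rightarrow> real" and i j assume i: "Suc i < p" and "j < p"
    let ?\<tau> = "Transposition.transpose i (Suc i)" and ?s = "simplical_face i s"
    let ?s' = "simplical_face (Suc i) s"
    have s': "?s' = ?s \<circ> ?\<tau>" by (rule simplical_face_Suc)
    have at_p: "?s' p = ?s p" using i by (simp add: s' Transposition.transpose_def)
    have \<tau>_p: "?\<tau> l < p \<longleftrightarrow> l < p" for l using i by (auto simp: Transposition.transpose_def)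
    have K': "K ?s' = ?\<tau> ` K ?s"
    proof -
      have "K ?s' = {l. ?\<tau> l \<in> K ?s}" by (auto simp: K_def s' \<tau>_p)
      also have "\<dots> = ?\<tau> ` K ?s"
        by (auto simp: image_iff) (metis transpose_involutory)
      finally show ?thesis .
    qed
    have "rescale p ?s' = rescale p ?s \<circ> ?\<tau>"
      using at_p by (auto simp: rescale_def s' \<tau>_p fun_eq_iff)
    moreover have "rescale p ?s i = 0" by (simp add: rescale_def simplical_face_def)
    \<comment> \<open>Position \<open>Suc i\<close> now holds the empty piece, which is outside
      \<open>K\<close> and hence irrelevant for \<open>A\<close>.\<close>
    ultimately have H': "H ?s' l = H ?s (?\<tau> l)" if "l \<noteq> Suc i" for l
      unfolding H_def at_p using that by (simp add: piece_swap)
    have "i \<notin> K ?s" by (auto simp: K_def simplical_face_def)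
    have "A ?s' = ?\<tau> ` A ?s"
    proof -
      have "Suc i \<notin> K ?s'" by (auto simp: K_def simplical_face_def)
      then have "A ?s' = {l \<in> K ?s'. H ?s (?\<tau> l) \<ge> 0}"
        using H' by (auto simp: A_def) metis+
      also have "\<dots> = ?\<tau> ` A ?s"
        by (auto simp: K' A_def)
      finally show ?thesis .
    qed
    moreover have "P ?s' = P ?s" by (simp add: P_def at_p)
    ultimately show "u ?s' j = u ?s (?\<tau> j)"
      unfolding u_def K' using \<open>j < p\<close> \<open>i \<notin> K ?s\<close> by (simp add: label_swap K)
  next
    fix s assume s: "s \<in> standard_simplex (p - 1)"
    let ?s = "simplical_face p s"
    \<comment> \<open>At path parameter 1 all pieces are the point 0 at height 1, so all values are
      positive and the label is the first nondegenerate piece.\<close>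
    have "?s p = 0" by (simp add: simplical_face_def)
    then have "H ?s i = F (0, 0, 1)" for i by (simp add: H_def c piece_def)
    then have pos: "H ?s i \<ge> 0" for i using sgn_iff(3)[of 0 1] by simp
    then show "(\<Sum>j<p. u ?s j) = 1" using sum_one[OF \<open>p > 0\<close>] by simp
    fix j assume j: "j < p" "s j = 0"
    have A: "A ?s = K ?s" using pos by (auto simp: A_def)
    have "K ?s \<noteq> {}"
    proof
      assume "K ?s = {}"
      then have "\<forall>l<p. s l = 0" by (auto simp: K_def simplical_face_def)
      then have "(\<Sum>l\<le>p - 1. s l) = 0" using \<open>p > 0\<close> by (intro sum.neutral) auto
      then show False using s by (simp add: standard_simplex_def)
    qed
    then have "Min (A ?s) \<in> K ?s" "A ?s \<noteq> {}" using K(3)[of ?s] by (simp_all add: A)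
    moreover have "j \<notin> K ?s" using j by (auto simp: K_def simplical_face_def)
    ultimately show "u ?s j = 0"
      by (auto simp: u_def label_def)
  next
    fix s assume s: "s \<in> standard_simplex p"
    show "\<exists>U. openin (simplex_top p) U \<and> s \<in> U \<and>
          ((\<exists>j<p. \<forall>t\<in>U. u t j = 0) \<or> (\<forall>t\<in>U. (\<Sum>j<p. u t j) = 1))"
    proof (cases "s p = 1")
      case True
      \<comment> \<open>Near the apex every piece is negative, so coordinate 0 of the label vanishes
        on a neighbourhood.\<close>
      have "F (0, 0, -1) < 0" by (simp add: sgn_iff)
      with F obtain e where e: "e > 0" "\<And>a b y t i. \<bar>a\<bar> < e \<Longrightarrow> \<bar>b\<bar> < e \<Longrightarrow> \<bar>y + 1\<bar> < e \<Longrightarrow>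
          (\<And>i. 0 \<le> (\<Sum>l<i. t l)) \<Longrightarrow> (\<And>i. (\<Sum>l<i. t l) \<le> 1) \<Longrightarrow> piece F (a, b, y) t i < 0"
        using piece_negative by metis
      obtain d where d: "d > 0" "\<And>\<tau>. \<tau> \<in> {0..1} \<Longrightarrow> dist \<tau> 0 < d \<Longrightarrow> dist (c \<tau>) (c 0) < e"
        using c(1) e(1) unfolding continuous_on_iff by (metis atLeastAtMost_iff order_refl zero_le_one)
      define U where "U = {t \<in> standard_simplex p. 1 - t p < d}"
      have "openin (simplex_top p) U"
      proof -
        have "openin (top_of_set (standard_simplex p)) (standard_simplex p \<inter> (\<lambda>t. 1 - t p) -` {..<d})"
          by (intro continuous_openin_preimage_gen continuous_intros continuous_on_coordinate)
        also have "standard_simplex p \<inter> (\<lambda>t. 1 - t p) -` {..<d} = U" by (auto simp: U_def)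
        finally show ?thesis by (simp only: top)
      qed
      moreover have "s \<in> U" using s True d by (simp add: U_def)
      moreover have "u t 0 = 0" if "t \<in> U" for t
      proof (rule u_zero[OF \<open>p > 0\<close>])
        have t: "t \<in> standard_simplex p" "1 - t p < d" using that by (auto simp: U_def)
        obtain a b y where aby: "c (1 - t p) = (a, b, y)" by (cases "c (1 - t p)")
        have "dist (a, b, y) (0, 0, -1) < e"
          using d(2)[of "1 - t p"] t s_bounds[OF t(1)] by (simp add: aby c)
        moreover have "\<bar>a\<bar> \<le> dist (a, b, y) (0, 0, -1)"
          using dist_fst_le[of "(a, b, y)" "(0, 0, -1)"] by simp
        moreover have "dist (b, y) (0, -1) \<le> dist (a, b, y) (0, 0, -1)"
          using dist_snd_le[of "(a, b, y)" "(0, 0, -1)"] by simp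
        moreover have "\<bar>b\<bar> \<le> dist (b, y) (0, -1)"
          using dist_fst_le[of "(b, y)" "(0, -1)"] by simp
        moreover have "\<bar>y + 1\<bar> \<le> dist (b, y) (0, -1)"
          using dist_snd_le[of "(b, y)" "(0, -1)"] by (simp add: dist_real_def)
        ultimately show "H t 0 < 0"
          unfolding H_def aby using rescale_partial_sum[OF t(1) \<open>p > 0\<close>] by (intro e(2)) auto
      qed
      ultimately show ?thesis using \<open>p > 0\<close> by blast
    next
      case False
      let ?W = "{s \<in> standard_simplex p. s p \<noteq> 1}"
      have W: "openin (simplex_top p) ?W"
      proof -
        have "openin (top_of_set (standard_simplex p)) (standard_simplex p \<inter> (\<lambda>t. t p) -` (- {1}))"
          by (intro continuous_openin_preimage_gen continuous_on_coordinate) auto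
        also have "standard_simplex p \<inter> (\<lambda>t. t p) -` (- {1}) = ?W" by auto
        finally show ?thesis by (simp add: top)
      qed
      have open_H: "openin (simplex_top p) {t \<in> ?W. H t i \<in> B}" if "i < p" "open B" for i B
      proof -
        have "openin (top_of_set ?W) (?W \<inter> (\<lambda>t. H t i) -` B)"
          unfolding H_def using that
          by (intro continuous_openin_preimage_gen continuous_on_piece_rescale F c)
        moreover have "?W \<inter> (\<lambda>t. H t i) -` B = {t \<in> ?W. H t i \<in> B}" by auto
        ultimately have "openin (top_of_set ?W) {t \<in> ?W. H t i \<in> B}" by (simp only:)
        then show ?thesis
          using W unfolding top by (rule openin_trans)
      qed
      have "rescale p s \<in> standard_simplex (p - 1)"
        using s False \<open>p > 0\<close> by (rule rescale_in_simplex)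
      \<comment> \<open>The path misses the equipartitions, so some value is nonzero. It keeps its
        sign nearby: a negative one makes a coordinate vanish, a positive one makes the sum
        1.\<close>
      then have "\<exists>i<p. H s i \<noteq> 0"
        using * s_bounds[OF s, of p] by (auto simp: equipartitions_def H_def)
      then obtain i where i: "i < p" "H s i \<noteq> 0" by blast
      show ?thesis
      proof (cases "H s i < 0")
        case True
        show ?thesis
        proof (intro exI[of _ "{t \<in> ?W. H t i \<in> {..<0}}"] conjI)
          show "openin (simplex_top p) {t \<in> ?W. H t i \<in> {..<0}}"
            using i by (intro open_H) auto
        qed (use True s False i u_zero in auto)
      next
        case F: False
        show ?thesis
        proof (intro exI[of _ "{t \<in> ?W. H t i \<in> {0<..}}"] conjI)
          show "openin (simplex_top p) {t \<in> ?W. H t i \<in> {0<..}}"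
            using i by (intro open_H) auto
        qed (use F s False i in \<open>auto intro!: sum_one[of i]\<close>)
      qed
    qed
  qed
qed

section \<open>Iteration over prime factors\<close>

text \<open>The diagonal condition encodes that \<open>f\<close> vanishes on degenerate segments.
  Points with \<open>a > b\<close> are included, and \<open>R\<close> is uniform in \<open>a\<close>
  and \<open>b\<close>.\<close>

definition sign_changing :: "(real \<times> real \<times> real \<Rightarrow> real) \<Rightarrow> bool" where
  "sign_changing F \<longleftrightarrow> continuous_on UNIV F \<and> (\<forall>a y. sgn (F (a, a, y)) = sgn y) \<and>
     (\<exists>R>0. \<forall>a b y. (y \<ge> R \<longrightarrow> F (a, b, y) > 0) \<and> (y \<le> - R \<longrightarrow> F (a, b, y) < 0))"

text \<open>The projection along the compact simplex of partitions is a closed map.\<close>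

lemma closed_equipartitions:
  assumes F: "continuous_on UNIV F"
  shows "closed (equipartitions F p)"
proof -
  let ?\<Delta> = "standard_simplex (p - 1)"
  let ?Z = "{z \<in> ?\<Delta> \<times> UNIV. \<forall>i<p. piece F (snd z) (fst z) i = 0}"
  have cont: "continuous_on UNIV (\<lambda>z :: (nat \<Rightarrow> real) \<times> real \<times> real \<times> real. piece F (snd z) (fst z) i)" for i
  proof -
    have coord: "continuous_on UNIV (\<lambda>z :: (nat \<Rightarrow> real) \<times> real \<times> real \<times> real. fst z l)" for l
      by (rule continuous_on_compose2[OF continuous_on_coordinate[of UNIV l] continuous_on_fst[OF continuous_on_id]]) simp
    show ?thesis
      unfolding piece_def case_prod_unfold
      by (intro continuous_on_compose2[OF F]) (auto intro!: continuous_intros coord)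
  qed
  have "closed (\<Inter>i<p. {z. piece F (snd z) (fst z) i = 0})"
    by (intro closed_INT ballI closed_Collect_eq cont continuous_on_const)
  moreover have "?Z = ?\<Delta> \<times> UNIV \<inter> (\<Inter>i<p. {z. piece F (snd z) (fst z) i = 0})"
    by auto
  ultimately have "closedin (top_of_set (?\<Delta> \<times> UNIV)) ?Z"
    unfolding closedin_closed by blast
  moreover have "compact_space (top_of_set ?\<Delta>)"
    using compactin_standard_simplex[of "p - 1"]
    by (simp add: compactin_subspace euclidean_product_topology)
  then have "closed_map (prod_topology (top_of_set ?\<Delta>) euclidean) (euclidean :: (real \<times> real \<times> real) topology) snd"
    by (rule Abstract_Topological_Spaces.closed_map_snd)
  then have "closed_map (top_of_set (?\<Delta> \<times> UNIV)) (euclidean :: (real \<times> real \<times> real) topology) snd"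
    using prod_topology_subtopology_eu[of ?\<Delta> "UNIV :: (real \<times> real \<times> real) set"] by simp
  ultimately have "closed (snd ` ?Z)"
    by (auto simp: closed_map_def)
  also have "snd ` ?Z = equipartitions F p"
    by (force simp: equipartitions_def)
  finally show ?thesis .
qed

section \<open>Separation of the bottom from the top\<close>

lemma path_component_convex:
  fixes T :: "'a::real_normed_vector set"
  assumes "convex T" "T \<subseteq> S" "x \<in> T" "y \<in> T"
  shows "path_component S x y"
  using convex_imp_path_connected[OF assms(1)] assms
  by (meson path_component_of_subset path_connected_component)

lemma convex_diagonal:
  fixes B :: "real set"
  assumes "convex B"
  shows "convex ((\<lambda>z. (fst z, fst z, snd z)) ` ((UNIV :: real set) \<times> B))"
  using assms by (intro convex_linear_image convex_Times convex_UNIV) (simp_all add: linear_iff)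

lemma equipartitions_contain_zero_set:
  assumes p: "prime p" and "sign_changing F"
  obtains G where "sign_changing G" "\<And>q. G q = 0 \<Longrightarrow> q \<in> equipartitions F p"
proof -
  obtain R where F: "continuous_on UNIV F" and diag: "\<And>a y. sgn (F (a, a, y)) = sgn y"
    and R: "R > 0" "\<And>a b y. y \<ge> R \<Longrightarrow> F (a, b, y) > 0" "\<And>a b y. y \<le> - R \<Longrightarrow> F (a, b, y) < 0"
    using assms(2) unfolding sign_changing_def by metis
  have "p > 0" using p prime_gt_0_nat by blast
  define S where "S = equipartitions F p"
  have "closed S" unfolding S_def by (rule closed_equipartitions[OF F])
  define C where "C = path_component_set (- S) (0, 0, -1)"
  have "C \<subseteq> - S" unfolding C_def by (rule path_component_subset)
  have not_S: "(a, b, y) \<notin> S" if "\<And>x z. F (x, z, y) \<noteq> 0" for a b y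
    using that \<open>p > 0\<close> by (auto simp: S_def equipartitions_def piece_def)
  have diag_S: "(a, a, y) \<in> S \<longleftrightarrow> y = 0" for a y
  proof -
    have "piece F (a, a, y) t i = 0 \<longleftrightarrow> y = 0" for t i
      using diag[of a y] by (simp add: piece_def sgn_if split: if_splits)
    then show ?thesis
      using nonempty_standard_simplex[of "p - 1"] \<open>p > 0\<close> by (auto simp: S_def equipartitions_def)
  qed
  have far: "(a, b, y) \<notin> S" if "y \<ge> R \<or> y \<le> - R" for a b y
    using that R(2,3) by (intro not_S) (metis less_irrefl)
  have top_notin: "(0, 0, 1) \<notin> C"
  proof
    assume "(0, 0, 1) \<in> C"
    then obtain g where g: "path g" "path_image g \<subseteq> - S" "pathstart g = (0, 0, -1)" "pathfinish g = (0, 0, 1)"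
      by (auto simp: C_def path_component_def)
    then have "\<exists>\<tau>\<in>{0..1}. g \<tau> \<in> S"
      unfolding S_def by (intro equipartitions_meet_path p F diag)
        (auto simp: path_def pathstart_def pathfinish_def)
    then show False using g by (auto simp: path_image_def)
  qed
  \<comment> \<open>Such points are joined to the top inside \<open>- S\<close>, within a half space
    or the upper half of the diagonal plane; \<open>neg\<close> is the mirror image.\<close>
  have pos: "(a, b, y) \<notin> C" if "y \<ge> R \<or> a = b \<and> y > 0" for a b y
  proof
    assume C: "(a, b, y) \<in> C"
    have line: "path_component (- S) (a, a, y) (0, 0, 1)" if "y > 0" for a y
      using diag_S that
      by (intro path_component_convex[OF convex_diagonal[of "{0<..}"]]) (auto simp: image_iff)
    have "path_component (- S) (a, b, y) (0, 0, 1)"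
    proof (cases "y \<ge> R")
      case True
      have "path_component (- S) (a, b, y) (0, 0, y)"
        using far True
        by (intro path_component_convex[of "UNIV \<times> UNIV \<times> {R..}"]) (auto intro!: convex_Times)
      moreover have "path_component (- S) (0, 0, y) (0, 0, 1)" using line True R(1) by simp
      ultimately show ?thesis by (rule path_component_trans)
    qed (use that line in auto)
    then show False
      using C top_notin unfolding C_def by (auto intro: path_component_trans)
  qed
  have neg: "(a, b, y) \<in> C" if "y \<le> - R \<or> a = b \<and> y < 0" for a b y
  proof -
    have line: "path_component (- S) (0, 0, -1) (a, a, y)" if "y < 0" for a y
      using diag_S that
      by (intro path_component_convex[OF convex_diagonal[of "{..<0}"]]) (auto simp: image_iff)
    have "path_component (- S) (0, 0, -1) (a, b, y)"
    proof (cases "y \<le> - R")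
      case True
      have "path_component (- S) (0, 0, y) (a, b, y)"
        using far True
        by (intro path_component_convex[of "UNIV \<times> UNIV \<times> {..- R}"]) (auto intro!: convex_Times)
      moreover have "path_component (- S) (0, 0, -1) (0, 0, y)" using line True R(1) by simp
      ultimately show ?thesis by (blast intro: path_component_trans)
    qed (use that line in auto)
    then show ?thesis by (simp add: C_def)
  qed
  \<comment> \<open>The signed distance to \<open>S\<close>, negative on the component of the
    bottom. Components of the open set \<open>- S\<close> are open, so \<open>C \<union> S\<close>
    and \<open>- C\<close> are closed; they overlap in \<open>S\<close>, where both branches
    vanish.\<close>
  define G where "G q = (if q \<in> C \<union> S then - infdist q S else infdist q S)" for q
  have "(0, 0, 0) \<in> S" by (simp add: diag_S)
  then have "S \<noteq> {}" by blast
  have zero: "infdist q S = 0 \<longleftrightarrow> q \<in> S" for q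
    by (rule in_closed_iff_infdist_zero[OF \<open>closed S\<close> \<open>S \<noteq> {}\<close>, symmetric])
  then have dist_pos: "infdist q S > 0" if "q \<notin> S" for q
    using infdist_nonneg[of q S] that by (metis less_eq_real_def)
  show thesis
  proof (rule that)
    show "q \<in> equipartitions F p" if "G q = 0" for q
      using that zero by (auto simp: G_def S_def split: if_splits)
    have "open C" "open (- S - C)"
      unfolding C_def using \<open>closed S\<close> by (simp_all add: open_path_component open_non_path_component open_Compl)
    moreover have "C \<union> S = - (- S - C)" using \<open>C \<subseteq> - S\<close> by auto
    ultimately have "closed (C \<union> S)" "closed (- C)" by (simp_all only: closed_Compl) 
    then have "continuous_on ((C \<union> S) \<union> - C) G"
      unfolding G_def using zero by (intro continuous_on_cases) (auto intro!: continuous_intros)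
    moreover have "(C \<union> S) \<union> - C = UNIV" by auto
    ultimately have cont: "continuous_on UNIV G" by simp
    have G_pos: "G (a, b, y) > 0" if "y \<ge> R \<or> a = b \<and> y > 0" for a b y
      using pos[OF that] that far diag_S dist_pos by (auto simp: G_def)
    have G_neg: "G (a, b, y) < 0" if "y \<le> - R \<or> a = b \<and> y < 0" for a b y
      using neg[OF that] that far diag_S dist_pos by (auto simp: G_def)
    have "G (a, a, 0) = 0" for a by (simp add: G_def diag_S zero)
    then have "sgn (G (a, a, y)) = sgn y" for a y
      using G_pos[where b = a] G_neg[where b = a] by (cases y "0 :: real" rule: linorder_cases) auto
    then show "sign_changing G"
      unfolding sign_changing_def using cont R(1) G_pos G_neg by blast
  qed
qed

text \<open>Strong induction on \<open>m\<close> for all \<open>F\<close> at once: a solution for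
  \<open>G\<close> with \<open>k\<close> segments is refined by splitting each of them into
  \<open>p\<close> pieces, keeping the same \<open>y\<close>.\<close>

lemma equipartition_exists:
  assumes "m > 0" "sign_changing F"
  shows "\<exists>(x :: nat \<Rightarrow> real) y. x 0 = 0 \<and> x m = 1 \<and> (\<forall>i<m. x i \<le> x (Suc i) \<and> F (x i, x (Suc i), y) = 0)"
  using assms
proof (induction m arbitrary: F rule: less_induct)
  case (less m)
  show ?case
  proof (cases "m = 1")
    case True
    obtain R where F: "continuous_on UNIV F"
      and R: "R > 0" "\<And>a b y. y \<ge> R \<Longrightarrow> F (a, b, y) > 0" "\<And>a b y. y \<le> - R \<Longrightarrow> F (a, b, y) < 0"
      using less.prems(2) unfolding sign_changing_def by metis
    have "\<exists>y\<ge>-R. y \<le> R \<and> F (0, 1, y) = 0"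
    proof (rule IVT')
      show "continuous_on {-R..R} (\<lambda>y. F (0, 1, y))"
        by (rule continuous_on_compose2[OF F]) (auto intro!: continuous_intros)
    qed (use R(1) R(2)[of R 0 1] R(3)[of "-R" 0 1] in auto)
    then obtain y where "F (0, 1, y) = 0" by blast
    then show ?thesis
      using True by (intro exI[of _ real] exI[of _ y]) auto
  next
    case False
    then obtain p k where p: "prime p" and m: "m = p * k"
      using prime_factor_nat[of m] by (auto elim: dvdE)
    have "p > 1" using p prime_gt_1_nat by blast
    obtain G where G: "sign_changing G" "\<And>q. G q = 0 \<Longrightarrow> q \<in> equipartitions F p"
      using equipartitions_contain_zero_set[OF p less.prems(2)] by metis
    have "k > 0" "k < m" using m less.prems(1) \<open>p > 1\<close> by auto
    then obtain x :: "nat \<Rightarrow> real" and y where x: "x 0 = 0" "x k = 1"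
      "\<And>i. i < k \<Longrightarrow> x i \<le> x (Suc i)" and zero: "\<And>i. i < k \<Longrightarrow> G (x i, x (Suc i), y) = 0"
      using less.IH[OF _ _ G(1), of k] by blast
    have ex: "\<forall>i. \<exists>t. i < k \<longrightarrow> t \<in> standard_simplex (p - 1) \<and>
        (\<forall>j<p. piece F (x i, x (Suc i), y) t j = 0)"
      using G(2)[OF zero] by (auto simp: equipartitions_def)
    from choice[OF ex] obtain t where t: "\<And>i. i < k \<Longrightarrow> t i \<in> standard_simplex (p - 1)"
      "\<And>i j. i < k \<Longrightarrow> j < p \<Longrightarrow> piece F (x i, x (Suc i), y) (t i) j = 0"
      by blast
    \<comment> \<open>Division of \<open>j\<close> by \<open>p\<close> gives the coarse segment as
      quotient and the position inside it as remainder.\<close>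
    define X where "X j = x (j div p) + (\<Sum>l<j mod p. t (j div p) l) * (x (Suc (j div p)) - x (j div p))" for j
    show ?thesis
    proof (intro exI[of _ X] exI[of _ y] conjI allI impI)
      show "X 0 = 0" "X m = 1" using \<open>p > 1\<close> x(1,2) by (simp_all add: X_def m)
      fix j assume "j < m"
      define i r where "i = j div p" and "r = j mod p"
      have i: "i < k" using \<open>j < m\<close> by (simp add: i_def m mult.commute less_mult_imp_div_less)
      have r: "r < p" using \<open>p > 1\<close> by (simp add: r_def)
      have Xj: "X j = x i + (\<Sum>l<r. t i l) * (x (Suc i) - x i)"
        by (simp add: X_def i_def r_def)
      have XSuc: "X (Suc j) = x i + (\<Sum>l<Suc r. t i l) * (x (Suc i) - x i)"
      proof (cases "Suc r = p")
        \<comment> \<open>At the wrap-around the empty sum of the next segment and the full sum 1 of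
          this one both give \<open>x (Suc i)\<close>.\<close>
        case True
        then have "Suc j mod p = 0" "Suc j div p = Suc i"
          by (auto simp: i_def r_def mod_Suc div_Suc)
        moreover have "(\<Sum>l<Suc r. t i l) = 1"
        proof -
          have "(\<Sum>l\<le>r. t i l) = 1" using t(1)[OF i] True[symmetric] by (simp add: standard_simplex_def)
          then show ?thesis by (simp only: lessThan_Suc_atMost)
        qed
        ultimately show ?thesis by (simp add: X_def del: sum.lessThan_Suc)
      next
        case False
        then have "Suc j mod p = Suc r" "Suc j div p = i"
          using \<open>p > 1\<close> by (auto simp: i_def r_def mod_Suc div_Suc)
        then show ?thesis by (simp add: X_def del: sum.lessThan_Suc)
      qed
      show "F (X j, X (Suc j), y) = 0"
        using t(2)[OF i r] by (simp add: piece_def Xj XSuc del: sum.lessThan_Suc)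
      have "t i r \<ge> 0" using t(1)[OF i] by (simp add: standard_simplex_def)
      then show "X j \<le> X (Suc j)"
        using x(3)[OF i] by (simp add: Xj XSuc mult_right_mono)
    qed
  qed
qed

section \<open>Extension of the segment function and conclusion\<close>

lemma compact_segments: "compact segments"
proof -
  have "segments = ({0..1} \<times> {0..1}) \<inter> {z. fst z \<le> snd z}"
    by (auto simp: segments_def)
  also have "compact \<dots>"
    by (intro compact_Int_closed compact_Times compact_Icc closed_Collect_le continuous_intros)
  finally show ?thesis .
qed

theorem theorem1p1:
  fixes f :: "real \<times> real \<Rightarrow> real" and m :: nat
  assumes "continuous_on segments f"
    and "\<And>a. a \<in> {0..1} \<Longrightarrow> f (a, a) = 0"
    and "m > 0"
  shows "\<exists>x :: nat \<Rightarrow> real. x 0 = 0 \<and> x m = 1 \<and> (\<forall>i<m. x i \<le> x (Suc i)) \<and>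
           (\<forall>i<m. \<forall>j<m. f (x i, x (Suc i)) = f (x j, x (Suc j)))"
proof -
  \<comment> \<open>A retraction of the plane onto the segments extends \<open>f\<close>; pairs in
    the wrong order go to degenerate segments. A zero of \<open>F\<close> means that
    \<open>f\<close> takes the value \<open>y\<close>.\<close>
  define clamp where "clamp a = max 0 (min 1 a)" for a :: real
  define F where "F = (\<lambda>(a, b, y). y - f (clamp a, max (clamp a) (clamp b)))"
  have clamp: "(clamp a, max (clamp a) (clamp b)) \<in> segments" for a b
    by (auto simp: clamp_def segments_def)
  have "bounded (f ` segments)"
    using assms(1) compact_segments by (intro compact_imp_bounded compact_continuous_image)
  then obtain B where B: "B > 0" "\<And>z. z \<in> segments \<Longrightarrow> \<bar>f z\<bar> \<le> B"
    unfolding bounded_pos by auto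
  have "continuous_on UNIV F"
    unfolding F_def case_prod_unfold clamp_def
    by (intro continuous_intros continuous_on_compose2[OF assms(1)])
       (use clamp in \<open>auto simp: clamp_def\<close>)
  moreover have "sgn (F (a, a, y)) = sgn y" for a y
    using assms(2)[of "clamp a"] by (simp add: F_def clamp_def)
  \<comment> \<open>\<open>B\<close> bounds \<open>f\<close> in absolute value; the added 1 makes
    the signs strict.\<close>
  moreover have "F (a, b, y) > 0" if "y \<ge> B + 1" for a b y
    using B(2)[OF clamp[of a b]] that by (auto simp: F_def)
  moreover have "F (a, b, y) < 0" if "y \<le> - (B + 1)" for a b y
    using B(2)[OF clamp[of a b]] that by (auto simp: F_def)
  ultimately have "sign_changing F"
    unfolding sign_changing_def using \<open>B > 0\<close> by (intro conjI exI[of _ "B + 1"]) auto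
  then obtain x y where x: "x 0 = 0" "x m = 1" "\<And>i. i < m \<Longrightarrow> x i \<le> x (Suc i)"
    "\<And>i. i < m \<Longrightarrow> F (x i, x (Suc i), y) = 0"
    using equipartition_exists[OF assms(3)] by metis
  \<comment> \<open>All points lie between \<open>x 0 = 0\<close> and \<open>x m = 1\<close>, where
    clamping changes nothing.\<close>
  have mono: "x i \<le> x j" if "i \<le> j" "j \<le> m" for i j
    using that
  proof (induction rule: dec_induct)
    case (step n)
    then show ?case using x(3)[of n] by simp
  qed simp
  have "f (x i, x (Suc i)) = y" if "i < m" for i
  proof -
    have "0 \<le> x i" "x i \<le> x (Suc i)" "x (Suc i) \<le> 1"
      using mono[of 0 i] mono[of i "Suc i"] mono[of "Suc i" m] that x by auto
    then show ?thesis
      using x(4)[OF that] by (simp add: F_def clamp_def)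
  qed
  then show ?thesis
    using x(1-3) by (intro exI[of _ x]) auto
qed

end
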